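(* Let $X_n$ be a second-order recurrence sequence with initial values $X_0$ and $X_1$ and with recurrence $$X_n=c_1X_{n-1}+c_2X_{n-2},$$ extended to all integer indices. Then for any fixed integer $k$ (possibly negative) such that $X_k$ and $X_{k-1}$ are both non-zero, and for every integer $n\ge 0$, $$X_0X_{n+2}-X_1X_{n+1}=\frac{X_0X_2-X_1^2}{X_k}\sum_{i=0}^{n}\left(-\frac{c_2X_{k-1}}{X_k}\right)^{n-i}X_{i+k}.$$
   Context: Sequences and the constants $c_1,c_2$ take values in the real (or complex) numbers. "Second-order" means that $c_2\ne 0$. Terms with negative index are defined from $X_0,X_1$ by $X_{n-2}=\frac{1}{c_2}\left(X_n-c_1X_{n-1}\right)$, so that the recurrence holds for all integers $n$. *)

theory Defs
  imports Complex_Main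
begin

(* The class real_normed_field is the library's common generalisation of the real and the
   complex numbers; up to isomorphism these are its only instances. Negative indices are
   determined by the recurrence because c2 is non-zero; see the characterisation below. *)
definition second_order_recurrence ::
  "'a::real_normed_field \<Rightarrow> 'a \<Rightarrow> (int \<Rightarrow> 'a) \<Rightarrow> bool" where
  "second_order_recurrence c1 c2 X \<longleftrightarrow>
     c2 \<noteq> 0 \<and> (\<forall>n. X n = c1 * X (n - 1) + c2 * X (n - 2))"

lemma second_order_recurrence_iff_forward_backward:
  "second_order_recurrence c1 c2 X \<longleftrightarrow>
     c2 \<noteq> 0 \<and>
     (\<forall>n\<ge>2. X n = c1 * X (n - 1) + c2 * X (n - 2)) \<and>
     (\<forall>n<2. X (n - 2) = (1 / c2) * (X n - c1 * X (n - 1)))"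
proof (cases "c2 = 0")
  case False
  then have "X n = c1 * X (n - 1) + c2 * X (n - 2) \<longleftrightarrow>
      X (n - 2) = (1 / c2) * (X n - c1 * X (n - 1))" for n
    by (auto simp: field_simps)
  with False show ?thesis
    unfolding second_order_recurrence_def by (metis not_le)
qed (simp add: second_order_recurrence_def)

end

theory Submission
  imports Defs
begin

text \<open>
  Put \<open>L\<^sub>n = X\<^sub>0 X\<^sub>n\<^sub>+\<^sub>2 - X\<^sub>1 X\<^sub>n\<^sub>+\<^sub>1\<close>. This is a combination of shifts of \<open>X\<close>, so it satisfies
  the same recurrence, and \<open>L\<^sub>-\<^sub>1 = 0\<close>: up to the factor \<open>L\<^sub>0 = X\<^sub>0 X\<^sub>2 - X\<^sub>1\<^sup>2\<close> and an
  index shift by one it is the Lucas sequence of the recurrence. Hence the addition formula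
  \<open>X\<^sub>k L\<^sub>m + c\<^sub>2 X\<^sub>k\<^sub>-\<^sub>1 L\<^sub>m\<^sub>-\<^sub>1 = L\<^sub>0 X\<^sub>m\<^sub>+\<^sub>k\<close> holds (\<open>addition_formula\<close>). For fixed \<open>k\<close> with
  \<open>X\<^sub>k \<noteq> 0\<close> it is an inhomogeneous first-order recurrence for \<open>L\<close> with ratio
  \<open>- c\<^sub>2 X\<^sub>k\<^sub>-\<^sub>1 / X\<^sub>k\<close> and forcing term \<open>(L\<^sub>0 / X\<^sub>k) X\<^sub>m\<^sub>+\<^sub>k\<close>; the claimed sum is its solution by
  variation of constants.
\<close>

text \<open>
  The form \<open>X\<^sub>k L\<^sub>m + c\<^sub>2 X\<^sub>k\<^sub>-\<^sub>1 L\<^sub>m\<^sub>-\<^sub>1\<close> does not change when one index step is moved from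
  \<open>L\<close> to \<open>X\<close>: expanding \<open>L\<^sub>m\<close>, the two terms with \<open>L\<^sub>m\<^sub>-\<^sub>1\<close> combine to \<open>X\<^sub>k\<^sub>+\<^sub>1 L\<^sub>m\<^sub>-\<^sub>1\<close>. Moving
  all \<open>m\<close> steps ends at \<open>L\<^sub>-\<^sub>1 = 0\<close>.
\<close>

lemma addition_formula:
  fixes X L :: "int \<Rightarrow> 'a::real_normed_field"
  assumes X: "second_order_recurrence c1 c2 X"
    and L: "second_order_recurrence c1 c2 L"
    and "L (- 1) = 0"
  shows "X k * L (int m) + c2 * X (k - 1) * L (int m - 1) = L 0 * X (int m + k)"
proof (induction m arbitrary: k)
  case 0
  show ?case using \<open>L (- 1) = 0\<close> by simp
next
  case (Suc m)
  have L_rec: "L (int m + 1) = c1 * L (int m) + c2 * L (int m - 1)"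
    using L[unfolded second_order_recurrence_def, THEN conjunct2, rule_format, of "int m + 1"]
    by simp
  have X_rec: "X (k + 1) = c1 * X k + c2 * X (k - 1)"
    using X[unfolded second_order_recurrence_def, THEN conjunct2, rule_format, of "k + 1"]
    by simp
  have "X k * L (int m + 1) + c2 * X (k - 1) * L (int m)
      = X (k + 1) * L (int m) + c2 * X k * L (int m - 1)"
    unfolding L_rec X_rec by (simp add: algebra_simps)
  also have "\<dots> = L 0 * X (int m + (k + 1))"
    using Suc.IH[of "k + 1"] by simp
  finally show ?case by (simp add: algebra_simps)
qed

lemma second_order_recurrence_shift_combination:
  assumes "second_order_recurrence c1 c2 X"
  shows "second_order_recurrence c1 c2 (\<lambda>n. a * X (n + p) - b * X (n + q))"
proof -
  have X_rec: "X (n + j) = c1 * X (n - 1 + j) + c2 * X (n - 2 + j)" for n j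
    using assms[unfolded second_order_recurrence_def, THEN conjunct2, rule_format, of "n + j"]
    by (simp add: algebra_simps)
  have "a * X (n + p) - b * X (n + q)
      = c1 * (a * X (n - 1 + p) - b * X (n - 1 + q))
        + c2 * (a * X (n - 2 + p) - b * X (n - 2 + q))" for n
    unfolding X_rec[of n] by (simp add: algebra_simps)
  then show ?thesis
    using assms unfolding second_order_recurrence_def by blast
qed

lemma first_order_recurrence_solution:
  fixes u f :: "nat \<Rightarrow> 'a::comm_ring_1"
  assumes "u 0 = f 0" and "\<And>n. u (Suc n) = r * u n + f (Suc n)"
  shows "u n = (\<Sum>i=0..n. r ^ (n - i) * f i)"
proof (induction n)
  case 0
  show ?case using assms(1) by simp
next
  case (Suc n)
  have "(\<Sum>i=0..n. r ^ (Suc n - i) * f i) = r * (\<Sum>i=0..n. r ^ (n - i) * f i)"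
    unfolding sum_distrib_left
    by (intro sum.cong) (auto simp: Suc_diff_le mult.assoc)
  then show ?case
    using Suc.IH by (simp add: assms(2))
qed

theorem theorem2:
  fixes X :: "int \<Rightarrow> 'a::real_normed_field"
    and c1 c2 :: 'a
    and k :: int
    and n :: nat
  assumes "second_order_recurrence c1 c2 X"
    and "X k \<noteq> 0"
    and "X (k - 1) \<noteq> 0"
  shows "X 0 * X (int n + 2) - X 1 * X (int n + 1) =
    (X 0 * X 2 - (X 1)\<^sup>2) / X k *
      (\<Sum>i=0..n. (- (c2 * X (k - 1) / X k)) ^ (n - i) * X (int i + k))"
proof -
  define L where "L = (\<lambda>j::int. X 0 * X (j + 2) - X 1 * X (j + 1))"
  define r where "r = - (c2 * X (k - 1) / X k)"
  have L_rec: "second_order_recurrence c1 c2 L"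
    unfolding L_def using assms(1) by (rule second_order_recurrence_shift_combination)
  have "L (- 1) = 0"
    by (simp add: L_def)
  note addition = addition_formula[OF assms(1) L_rec this]
  have L_step: "L (int (Suc m)) = r * L (int m) + L 0 / X k * X (int (Suc m) + k)" for m
    using addition[of k "Suc m"] assms(2) by (simp add: r_def field_simps)
  have "L (int n) = (\<Sum>i=0..n. r ^ (n - i) * (L 0 / X k * X (int i + k)))"
    by (rule first_order_recurrence_solution[where u = "\<lambda>m. L (int m)"])
       (use L_step assms(2) in simp_all)
  also have "\<dots> = L 0 / X k * (\<Sum>i=0..n. r ^ (n - i) * X (int i + k))"
    by (simp add: sum_distrib_left mult.left_commute)
  finally show ?thesis
    by (simp add: L_def r_def power2_eq_square)
qed

end
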